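(* Let $q$ be an odd prime power and $\ell>1$ an integer. Every Budaghyan--Helleseth presemifield $\overline{BH}(q,\ell,d,\beta)$ of order $q^{2\ell}$ has middle nucleus of order $q^2$ and right nucleus, left nucleus and center all of order $q$.
   Context: A finite semifield $(S,+,\star)$ satisfies all axioms of a skewfield except possibly associativity of multiplication; a presemifield satisfies all axioms of a semifield except possibly existence of a multiplicative identity. The left, middle, right nucleus of a semifield are the sets of elements $a$ (resp. $b$, $c$) with $(a\star b)\star c=a\star(b\star c)$ for all choices of the other two elements; the center is the set of elements in all three nuclei commuting multiplicatively with every element. Presemifields $(S,+,\star)$, $(S',+,\star')$ of characteristic $p$ are isotopic if there are invertible $\mathbb{F}_p$-linear maps $g_1,g_2,g_3:S\to S'$ with $g_1(x)\star' g_2(y)=g_3(x\star y)$ for all $x,y$. Every presemifield is isotopic to a semifield, and the orders of nuclei and center are isotopy invariants of semifields; the orders of the nuclei and center of a presemifield are by definition those of any semifield isotopic to it. Budaghyan--Helleseth presemifields: let $q$ be an odd prime power, $\ell,d$ positive integers with $0<d<2\ell$ and $\gcd(\ell,d)=1$, $\omega\in\mathbb{F}_{q^{2\ell}}\setminus\mathbb{F}_{q^\ell}$ with $\omega^{q^\ell}=-\omega$, and $\beta\in\mathbb{F}_{q^{2\ell}}^*$ such that $\beta^{\frac{q^{2\ell}-1}{\gcd(q^\ell+1,q^d+1)}}\neq1$ and there is no $a\in\mathbb{F}_{q^{2\ell}}^*$ with $a+a^{q^\ell}=a+a^{q^d}=0$ (these two conditions are equivalent to: $\ell+d$ is odd and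 $\beta$ is a nonsquare in $\mathbb{F}_{q^{2\ell}}$). Then $\overline{BH}(q,\ell,d,\beta)=(\mathbb{F}_{q^{2\ell}},+,\star)$ is the commutative presemifield with $$x\star y=xy^{q^\ell}+x^{q^\ell}y+[\beta(xy^{q^d}+x^{q^d}y)+\beta^{q^\ell}(xy^{q^d}+x^{q^d}y)^{q^\ell}]\omega.$$ *)

theory Defs
  imports "HOL-Number_Theory.Number_Theory" "HOL-Library.Cardinality"
begin

text \<open>
  The additive group of a (pre)semifield is supplied by the type class, the multiplication is an
  explicit function. For finite structures the skewfield requirement of divisibility by nonzero
  elements amounts to the absence of zero divisors.
\<close>

locale presemifield =
  fixes star :: "'a::{ab_group_add, finite} \<Rightarrow> 'a \<Rightarrow> 'a"
  assumes distrib_left: "star x (y + z) = star x y + star x z"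
    and distrib_right: "star (x + y) z = star x z + star y z"
    and no_zero_divisors: "star x y = 0 \<Longrightarrow> x = 0 \<or> y = 0"
    and nontrivial: "\<exists>x::'a. x \<noteq> 0"

locale semifield = presemifield star
  for star :: "'a::{ab_group_add, finite} \<Rightarrow> 'a \<Rightarrow> 'a" +
  assumes has_identity: "\<exists>e. e \<noteq> 0 \<and> (\<forall>x. star e x = x \<and> star x e = x)"

definition left_nucleus :: "('a \<Rightarrow> 'a \<Rightarrow> 'a) \<Rightarrow> 'a set" where
  "left_nucleus star = {a. \<forall>b c. star (star a b) c = star a (star b c)}"

definition middle_nucleus :: "('a \<Rightarrow> 'a \<Rightarrow> 'a) \<Rightarrow> 'a set" where
  "middle_nucleus star = {b. \<forall>a c. star (star a b) c = star a (star b c)}"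

definition right_nucleus :: "('a \<Rightarrow> 'a \<Rightarrow> 'a) \<Rightarrow> 'a set" where
  "right_nucleus star = {c. \<forall>a b. star (star a b) c = star a (star b c)}"

definition semifield_center :: "('a \<Rightarrow> 'a \<Rightarrow> 'a) \<Rightarrow> 'a set" where
  "semifield_center star =
     {c \<in> left_nucleus star \<inter> middle_nucleus star \<inter> right_nucleus star. \<forall>x. star c x = star x c}"

text \<open>
  In an additive group of exponent \<open>p\<close>, the scalar \<open>c\<close> of the prime field with \<open>p\<close> elements,
  represented by \<open>c < p\<close>, acts as \<open>c\<close>-fold addition.
\<close>

definition prime_field_scale :: "nat \<Rightarrow> 'a::ab_group_add \<Rightarrow> 'a" where
  "prime_field_scale c x = (\<Sum>i<c. x)"

definition prime_field_linear ::
    "nat \<Rightarrow> ('a::ab_group_add \<Rightarrow> 'b::ab_group_add) \<Rightarrow> bool" where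
  "prime_field_linear p g \<longleftrightarrow>
     additive g \<and>
     (\<forall>c<p. \<forall>x. g (prime_field_scale c x) = prime_field_scale c (g x))"

definition isotopic ::
    "('a::ab_group_add \<Rightarrow> 'a \<Rightarrow> 'a) \<Rightarrow> ('b::ab_group_add \<Rightarrow> 'b \<Rightarrow> 'b) \<Rightarrow> bool" where
  "isotopic star star' \<longleftrightarrow>
     (\<exists>p. prime p \<and>
        (\<forall>x::'a. prime_field_scale p x = 0) \<and> (\<forall>x::'b. prime_field_scale p x = 0) \<and>
        (\<exists>g1 g2 g3.
           prime_field_linear p g1 \<and> bij g1 \<and>
           prime_field_linear p g2 \<and> bij g2 \<and>
           prime_field_linear p g3 \<and> bij g3 \<and>
           (\<forall>x y. star' (g1 x) (g2 y) = g3 (star x y))))"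

text \<open>
  The subfield with \<open>n\<close> elements of a finite field whose order is a power of \<open>n\<close>
  (\<open>n\<close> a prime power) is the fixed set of \<open>x \<mapsto> x ^ n\<close>.
\<close>

definition subfield_of_order :: "nat \<Rightarrow> 'a::field set" where
  "subfield_of_order n = {x. x ^ n = x}"

definition BH_parameters ::
    "nat \<Rightarrow> nat \<Rightarrow> nat \<Rightarrow> 'a::finite_field \<Rightarrow> 'a \<Rightarrow> bool" where
  "BH_parameters q l d \<beta> \<omega> \<longleftrightarrow>
     primepow q \<and> odd q \<and> 0 < l \<and> 0 < d \<and> d < 2 * l \<and> coprime l d \<and>
     CARD('a) = q ^ (2 * l) \<and>
     \<omega> \<notin> subfield_of_order (q ^ l) \<and> \<omega> ^ (q ^ l) = - \<omega> \<and>
     \<beta> \<noteq> 0 \<and> \<beta> ^ ((q ^ (2 * l) - 1) div gcd (q ^ l + 1) (q ^ d + 1)) \<noteq> 1 \<and>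
     \<not> (\<exists>a::'a. a \<noteq> 0 \<and> a + a ^ (q ^ l) = 0 \<and> a + a ^ (q ^ d) = 0)"

definition BH_mult ::
    "nat \<Rightarrow> nat \<Rightarrow> nat \<Rightarrow> 'a::field \<Rightarrow> 'a \<Rightarrow> 'a \<Rightarrow> 'a \<Rightarrow> 'a" where
  "BH_mult q l d \<beta> \<omega> x y =
     x * y ^ (q ^ l) + x ^ (q ^ l) * y
     + (\<beta> * (x * y ^ (q ^ d) + x ^ (q ^ d) * y)
        + \<beta> ^ (q ^ l) * (x * y ^ (q ^ d) + x ^ (q ^ d) * y) ^ (q ^ l)) * \<omega>"

end

theory Submission
  imports Defs "HOL-Computational_Algebra.Polynomial"
begin

text \<open>
  The nuclei and the center are first rewritten in a form that makes sense for a presemifield and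
  that isotopisms visibly preserve. In a semifield the middle nucleus corresponds to the pairs of
  maps \<open>(A, B)\<close> with \<open>A x \<star> y = x \<star> B y\<close>, the left nucleus to the pairs \<open>(A, C)\<close> with
  \<open>A x \<star> y = C (x \<star> y)\<close>, and similarly for the right nucleus and the center. An isotopism acts on
  these pairs by conjugation, so they may be counted for the Budaghyan--Helleseth multiplication
  itself (\<open>card_nuclei_unital\<close>, \<open>card_pairs_isotopic\<close>).

  Absence of zero divisors comes down to the two conditions on the parameters: a zero divisor would
  give an element negated by both Frobenius maps below, or force the forbidden relation for \<open>\<beta>\<close>
  (\<open>no_zero_divisors\<close>). An isotopic semifield then exists by Kaplansky's trick.

  Let \<open>F\<close> be the field with \<open>q ^ (2 * l)\<close> elements, write \<open>bar\<close> for the involution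
  \<open>x \<mapsto> x ^ (q ^ l)\<close>, \<open>K\<close> for its fixed field, \<open>tr x = x + bar x\<close> for the trace to \<open>K\<close>, and
  \<open>phi x = x ^ (q ^ d)\<close>. Since \<open>F\<close> is the direct sum of \<open>K\<close> and \<open>K * \<omega>\<close>, the multiplication
  amounts to two \<open>K\<close>-valued forms
    \<open>form1 x y = tr (x * bar y)\<close> and \<open>form2 x y = tr (\<beta> * (x * phi y + phi x * y))\<close>,
  where \<open>form1\<close> is \<open>K\<close>-bilinear and nondegenerate, while \<open>form2\<close> is not \<open>K\<close>-bilinear. Playing these
  two facts against each other yields everything, by scaling one argument with an element \<open>k\<close> of
  \<open>K\<close> that \<open>phi\<close> moves; such a \<open>k\<close> exists because \<open>l > 1\<close>.

  For the middle nucleus, adjointness with respect to \<open>form1\<close> makes \<open>A\<close> linear over \<open>K\<close>, so that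
  \<open>A x = a * x + b * bar x\<close>, and it determines \<open>B\<close>. Adjointness with respect to \<open>form2\<close> then becomes
  the pair of equations \<open>phi a = bar a\<close> and \<open>\<beta> * phi b = bar \<beta> * bar b\<close>
  (\<open>form2_mid_imp\<close>). As \<open>l + d\<close> is odd and coprime to \<open>l\<close>, the first has exactly the solutions
  \<open>a ^ q = a\<close>, and the second has a one-dimensional solution space over the field with \<open>q\<close>
  elements. Hence there are \<open>q * q\<close> pairs (\<open>card_middle_pairs_BH\<close>).

  For the left nucleus, commutativity turns \<open>A x \<star> y = C (x \<star> y)\<close> into \<open>A x \<star> y = x \<star> A y\<close>, so
  \<open>A\<close> is again linear over \<open>K\<close>. The key fact is \<open>additive_vanishing_on_alternating\<close>: an additive map
  that kills all \<open>x * phi y - phi x * y\<close> is zero. It shows that the \<open>K\<close>-component of \<open>C\<close> ignores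
  the summand \<open>K * \<omega>\<close>, which forces \<open>A\<close> to be multiplication by some \<open>c\<close> in \<open>K\<close>, and a second
  application gives \<open>phi c = c\<close>, that is \<open>c ^ q = c\<close> (\<open>left_pair_BH\<close>). By commutativity the right
  nucleus and the center are given by the same \<open>q\<close> scalars.
\<close>

section \<open>Nuclei as isotopy invariants\<close>

text \<open>
  The maps in these sets range over all functions rather than over additive ones: in a semifield the
  defining equations already force them to be multiplications by a nuclear element, and conjugation
  with arbitrary bijections then preserves them.
\<close>

definition left_pairs :: "('a \<Rightarrow> 'a \<Rightarrow> 'a) \<Rightarrow> (('a \<Rightarrow> 'a) \<times> ('a \<Rightarrow> 'a)) set" where
  "left_pairs star = {(A, C). \<forall>x y. star (A x) y = C (star x y)}"

definition middle_pairs :: "('a \<Rightarrow> 'a \<Rightarrow> 'a) \<Rightarrow> (('a \<Rightarrow> 'a) \<times> ('a \<Rightarrow> 'a)) set" where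
  "middle_pairs star = {(A, B). \<forall>x y. star (A x) y = star x (B y)}"

definition right_pairs :: "('a \<Rightarrow> 'a \<Rightarrow> 'a) \<Rightarrow> (('a \<Rightarrow> 'a) \<times> ('a \<Rightarrow> 'a)) set" where
  "right_pairs star = {(B, C). \<forall>x y. star x (B y) = C (star x y)}"

definition central_triples ::
    "('a \<Rightarrow> 'a \<Rightarrow> 'a) \<Rightarrow> (('a \<Rightarrow> 'a) \<times> ('a \<Rightarrow> 'a) \<times> ('a \<Rightarrow> 'a)) set" where
  "central_triples star =
     {(A, B, C). \<forall>x y. star (A x) y = C (star x y) \<and> star x (B y) = C (star x y)}"

text \<open>
  Putting the identity for one of the arguments expresses all maps of a pair through the single
  element \<open>A e\<close> (or \<open>B e\<close>), and the defining equation becomes associativity for that element.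
\<close>

context
  fixes star :: "'a \<Rightarrow> 'a \<Rightarrow> 'a" and e :: 'a
  assumes identity [simp]: "\<And>x. star e x = x" "\<And>x. star x e = x"
begin

lemma left_pairs_unital: "left_pairs star = (\<lambda>a. (star a, star a)) ` left_nucleus star"
proof (intro equalityI subsetI)
  fix p assume "p \<in> left_pairs star"
  then obtain A C where p: "p = (A, C)" and *: "\<And>x y. star (A x) y = C (star x y)"
    by (auto simp: left_pairs_def)
  have A: "A = C" using *[of _ e] by auto
  have L: "star (A e) = C" using *[of e] by auto
  have "A e \<in> left_nucleus star"
    using * A L by (auto simp: left_nucleus_def)
  thus "p \<in> (\<lambda>a. (star a, star a)) ` left_nucleus star"
    by (rule rev_image_eqI) (simp add: p L[unfolded A] A)
qed (auto simp: left_pairs_def left_nucleus_def)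

lemma middle_pairs_unital:
  "middle_pairs star = (\<lambda>b. (\<lambda>x. star x b, star b)) ` middle_nucleus star"
proof (intro equalityI subsetI)
  fix p assume "p \<in> middle_pairs star"
  then obtain A B where p: "p = (A, B)" and *: "\<And>x y. star (A x) y = star x (B y)"
    by (auto simp: middle_pairs_def)
  have L: "star (A e) = B" using *[of e] by auto
  hence "A e = B e" using identity(2) by metis
  hence R: "(\<lambda>x. star x (A e)) = A" using *[of _ e] by auto
  have "star (star x (A e)) y = star x (star (A e) y)" for x y
    using *[of x y] L fun_cong[OF R, of x] by simp
  hence "A e \<in> middle_nucleus star" by (simp add: middle_nucleus_def)
  thus "p \<in> (\<lambda>b. (\<lambda>x. star x b, star b)) ` middle_nucleus star"
    by (rule rev_image_eqI) (simp add: p L R)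
qed (auto simp: middle_pairs_def middle_nucleus_def)

lemma right_pairs_unital:
  "right_pairs star = (\<lambda>c. (\<lambda>x. star x c, \<lambda>x. star x c)) ` right_nucleus star"
proof (intro equalityI subsetI)
  fix p assume "p \<in> right_pairs star"
  then obtain B C where p: "p = (B, C)" and *: "\<And>x y. star x (B y) = C (star x y)"
    by (auto simp: right_pairs_def)
  have B: "B = C" using *[of e] by auto
  have R: "star x (B e) = C x" for x using *[of x e] by simp
  have "B e \<in> right_nucleus star"
    using * B R by (simp add: right_nucleus_def)
  thus "p \<in> (\<lambda>c. (\<lambda>x. star x c, \<lambda>x. star x c)) ` right_nucleus star"
    by (rule rev_image_eqI) (simp add: p B R[unfolded B])
qed (auto simp: right_pairs_def right_nucleus_def)

lemma central_triples_unital: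
  "central_triples star = (\<lambda>c. (star c, star c, star c)) ` semifield_center star"
proof (intro equalityI subsetI)
  fix p assume "p \<in> central_triples star"
  then obtain A B C where p: "p = (A, B, C)"
    and *: "\<And>x y. star (A x) y = C (star x y)" "\<And>x y. star x (B y) = C (star x y)"
    by (auto simp: central_triples_def)
  have A: "A = C" using *(1)[of _ e] by auto
  have B: "B = C" using *(2)[of e] by auto
  have L: "star (A e) = C" using *(1)[of e] by auto
  have comm: "star (A e) x = star x (A e)" for x using *(2)[of x e] A B L by simp
  have "A e \<in> semifield_center star"
    unfolding semifield_center_def left_nucleus_def middle_nucleus_def right_nucleus_def
    using * comm A B L by auto
  thus "p \<in> (\<lambda>c. (star c, star c, star c)) ` semifield_center star"
    by (rule rev_image_eqI) (simp add: p A B L[unfolded A])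
next
  fix p assume "p \<in> (\<lambda>c. (star c, star c, star c)) ` semifield_center star"
  then obtain c where p: "p = (star c, star c, star c)" and c: "c \<in> semifield_center star"
    by auto
  hence "star x (star c y) = star c (star x y)" for x y
    unfolding semifield_center_def left_nucleus_def middle_nucleus_def by (auto; metis)
  thus "p \<in> central_triples star"
    using c by (auto simp: p central_triples_def semifield_center_def left_nucleus_def)
qed

lemma card_nuclei_unital:
  "card (left_nucleus star) = card (left_pairs star)"
  "card (middle_nucleus star) = card (middle_pairs star)"
  "card (right_nucleus star) = card (right_pairs star)"
  "card (semifield_center star) = card (central_triples star)"
proof -
  have eqD: "a = b" if "star a = star b" for a b
    using fun_cong[OF that, of e] by simp
  have eqD': "a = b" if "(\<lambda>x. star x a) = (\<lambda>x. star x b)" for a b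
    using fun_cong[OF that, of e] by simp
  show
    "card (left_nucleus star) = card (left_pairs star)"
    "card (middle_nucleus star) = card (middle_pairs star)"
    "card (right_nucleus star) = card (right_pairs star)"
    "card (semifield_center star) = card (central_triples star)"
    unfolding left_pairs_unital middle_pairs_unital right_pairs_unital central_triples_unital
    by (subst card_image; auto intro!: inj_onI dest: eqD eqD')+
qed

end

context
  fixes star :: "'a \<Rightarrow> 'a \<Rightarrow> 'a" and star' :: "'b \<Rightarrow> 'b \<Rightarrow> 'b"
    and g1 g2 g3 :: "'a \<Rightarrow> 'b" and h1 h2 h3 :: "'b \<Rightarrow> 'a"
  assumes inverses [simp]:
      "\<And>x. h1 (g1 x) = x" "\<And>x. h2 (g2 x) = x" "\<And>x. h3 (g3 x) = x"
      "\<And>x. g1 (h1 x) = x" "\<And>x. g2 (h2 x) = x" "\<And>x. g3 (h3 x) = x"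
    and isotopism: "\<And>x y. star' (g1 x) (g2 y) = g3 (star x y)"
begin

lemma isotopism_pullback: "star' x y = g3 (star (h1 x) (h2 y))"
  using isotopism[of "h1 x" "h2 y"] by simp

lemma isotopism_pushforward: "star x y = h3 (star' (g1 x) (g2 y))"
  by (simp add: isotopism)

lemma card_left_pairs_isotopic: "card (left_pairs star) = card (left_pairs star')"
proof (rule bij_betw_same_card)
  show "bij_betw (\<lambda>(A, C). (g1 \<circ> A \<circ> h1, g3 \<circ> C \<circ> h3)) (left_pairs star) (left_pairs star')"
  proof (rule bij_betw_byWitness[where f' = "\<lambda>(A, C). (h1 \<circ> A \<circ> g1, h3 \<circ> C \<circ> g3)"])
    show "(\<lambda>(A, C). (g1 \<circ> A \<circ> h1, g3 \<circ> C \<circ> h3)) ` left_pairs star \<subseteq> left_pairs star'"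
      by (auto simp: left_pairs_def isotopism_pullback)
    show "(\<lambda>(A, C). (h1 \<circ> A \<circ> g1, h3 \<circ> C \<circ> g3)) ` left_pairs star' \<subseteq> left_pairs star"
      by (auto simp: left_pairs_def isotopism_pushforward)
  qed (auto simp: fun_eq_iff)
qed

lemma card_right_pairs_isotopic: "card (right_pairs star) = card (right_pairs star')"
proof (rule bij_betw_same_card)
  show "bij_betw (\<lambda>(B, C). (g2 \<circ> B \<circ> h2, g3 \<circ> C \<circ> h3)) (right_pairs star) (right_pairs star')"
  proof (rule bij_betw_byWitness[where f' = "\<lambda>(B, C). (h2 \<circ> B \<circ> g2, h3 \<circ> C \<circ> g3)"])
    show "(\<lambda>(B, C). (g2 \<circ> B \<circ> h2, g3 \<circ> C \<circ> h3)) ` right_pairs star \<subseteq> right_pairs star'"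
      by (auto simp: right_pairs_def isotopism_pullback)
    show "(\<lambda>(B, C). (h2 \<circ> B \<circ> g2, h3 \<circ> C \<circ> g3)) ` right_pairs star' \<subseteq> right_pairs star"
      by (auto simp: right_pairs_def isotopism_pushforward)
  qed (auto simp: fun_eq_iff)
qed

lemma card_middle_pairs_isotopic: "card (middle_pairs star) = card (middle_pairs star')"
proof (rule bij_betw_same_card)
  show "bij_betw (\<lambda>(A, B). (g1 \<circ> A \<circ> h1, g2 \<circ> B \<circ> h2)) (middle_pairs star) (middle_pairs star')"
  proof (rule bij_betw_byWitness[where f' = "\<lambda>(A, B). (h1 \<circ> A \<circ> g1, h2 \<circ> B \<circ> g2)"])
    show "(\<lambda>(A, B). (g1 \<circ> A \<circ> h1, g2 \<circ> B \<circ> h2)) ` middle_pairs star \<subseteq> middle_pairs star'"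
      by (auto simp: middle_pairs_def isotopism_pullback)
    show "(\<lambda>(A, B). (h1 \<circ> A \<circ> g1, h2 \<circ> B \<circ> g2)) ` middle_pairs star' \<subseteq> middle_pairs star"
      by (auto simp: middle_pairs_def isotopism_pushforward)
  qed (auto simp: fun_eq_iff)
qed

lemma card_central_triples_isotopic:
  "card (central_triples star) = card (central_triples star')"
proof (rule bij_betw_same_card)
  show "bij_betw (\<lambda>(A, B, C). (g1 \<circ> A \<circ> h1, g2 \<circ> B \<circ> h2, g3 \<circ> C \<circ> h3))
      (central_triples star) (central_triples star')"
  proof (rule bij_betw_byWitness[where
        f' = "\<lambda>(A, B, C). (h1 \<circ> A \<circ> g1, h2 \<circ> B \<circ> g2, h3 \<circ> C \<circ> g3)"])
    show "(\<lambda>(A, B, C). (g1 \<circ> A \<circ> h1, g2 \<circ> B \<circ> h2, g3 \<circ> C \<circ> h3)) ` central_triples star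
        \<subseteq> central_triples star'"
      by (auto simp: central_triples_def isotopism_pullback)
    show "(\<lambda>(A, B, C). (h1 \<circ> A \<circ> g1, h2 \<circ> B \<circ> g2, h3 \<circ> C \<circ> g3)) ` central_triples star'
        \<subseteq> central_triples star"
      by (auto simp: central_triples_def isotopism_pushforward)
  qed (auto simp: fun_eq_iff)
qed

end

text \<open>
  Together with \<open>card_nuclei_unital\<close>, this makes the orders of the nuclei and of the center of a
  semifield computable from any presemifield isotopic to it.
\<close>

lemma card_pairs_isotopic:
  assumes "isotopic star star'"
  shows "card (left_pairs star) = card (left_pairs star')"
    and "card (middle_pairs star) = card (middle_pairs star')"
    and "card (right_pairs star) = card (right_pairs star')"
    and "card (central_triples star) = card (central_triples star')"
proof -
  obtain g1 g2 g3 where g: "bij g1" "bij g2" "bij g3"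
    and isotopism: "\<And>x y. star' (g1 x) (g2 y) = g3 (star x y)"
    using assms unfolding isotopic_def by blast
  have inverse: "inv_into UNIV g (g x) = x" "g (inv_into UNIV g y) = y" if "bij g"
    for g :: "'a \<Rightarrow> 'b" and x y
    using that by (simp_all add: bij_is_inj bij_is_surj surj_f_inv_f)
  note instance_facts = inverse(1)[OF g(1)] inverse(1)[OF g(2)] inverse(1)[OF g(3)]
    inverse(2)[OF g(1)] inverse(2)[OF g(2)] inverse(2)[OF g(3)] isotopism
  show "card (left_pairs star) = card (left_pairs star')"
    by (rule card_left_pairs_isotopic) (rule instance_facts)+
  show "card (middle_pairs star) = card (middle_pairs star')"
    by (rule card_middle_pairs_isotopic) (rule instance_facts)+
  show "card (right_pairs star) = card (right_pairs star')"
    by (rule card_right_pairs_isotopic) (rule instance_facts)+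
  show "card (central_triples star) = card (central_triples star')"
    by (rule card_central_triples_isotopic) (rule instance_facts)+
qed

section \<open>Every presemifield is isotopic to a semifield\<close>

lemma additive_bij_inverse:
  assumes "additive f" "bij f"
  shows "additive (inv_into UNIV f)"
proof
  fix x y
  interpret additive f by fact
  show "inv_into UNIV f (x + y) = inv_into UNIV f x + inv_into UNIV f y"
    using assms(2) by (intro inv_into_f_eq) (auto simp: add bij_is_inj bij_is_surj surj_f_inv_f)
qed

lemma additive_imp_prime_field_linear:
  assumes "additive g"
  shows "prime_field_linear p g"
  using assms additive.sum[OF assms] by (auto simp: prime_field_linear_def prime_field_scale_def)

lemma isotopicI:
  fixes star :: "'a::ab_group_add \<Rightarrow> 'a \<Rightarrow> 'a" and star' :: "'b::ab_group_add \<Rightarrow> 'b \<Rightarrow> 'b"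
  assumes p: "prime p" "\<And>x::'a. prime_field_scale p x = 0" "\<And>x::'b. prime_field_scale p x = 0"
    and g: "additive g1" "bij g1" "additive g2" "bij g2" "additive g3" "bij g3"
    and isotopism: "\<And>x y. star' (g1 x) (g2 y) = g3 (star x y)"
  shows "isotopic star star'"
proof -
  have "\<forall>x y. star' (g1 x) (g2 y) = g3 (star x y)" using isotopism by blast
  hence "\<exists>g3. prime_field_linear p g1 \<and> bij g1 \<and> prime_field_linear p g2 \<and> bij g2 \<and>
      prime_field_linear p g3 \<and> bij g3 \<and> (\<forall>x y. star' (g1 x) (g2 y) = g3 (star x y))"
    using g g(1,3,5)[THEN additive_imp_prime_field_linear] by (intro exI[of _ g3]) simp
  hence "\<exists>g1 g2 g3. prime_field_linear p g1 \<and> bij g1 \<and> prime_field_linear p g2 \<and> bij g2 \<and>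
      prime_field_linear p g3 \<and> bij g3 \<and> (\<forall>x y. star' (g1 x) (g2 y) = g3 (star x y))"
    by (rule exI[of _ g1, OF exI[of _ g2]])
  thus ?thesis unfolding isotopic_def using p by (intro exI[of _ p]) simp
qed

context presemifield
begin

lemma additive_left: "additive (\<lambda>x. star x y)"
  by standard (rule distrib_right)

lemma additive_right: "additive (\<lambda>y. star x y)"
  by standard (rule distrib_left)

lemma left_cancel: "y \<noteq> 0 \<Longrightarrow> star x y = star x' y \<Longrightarrow> x = x'"
  using no_zero_divisors[of "x - x'" y] additive.diff[OF additive_left, of x x' y] by auto

lemma right_cancel: "x \<noteq> 0 \<Longrightarrow> star x y = star x y' \<Longrightarrow> y = y'"
  using no_zero_divisors[of x "y - y'"] additive.diff[OF additive_right, of x y y'] by auto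

lemma bij_left: "y \<noteq> 0 \<Longrightarrow> bij (\<lambda>x. star x y)"
  by (intro bijI finite_UNIV_inj_surj injI) (simp_all, (erule (1) left_cancel)+)

lemma bij_right: "x \<noteq> 0 \<Longrightarrow> bij (\<lambda>y. star x y)"
  by (intro bijI finite_UNIV_inj_surj injI) (simp_all, (erule (1) right_cancel)+)

text \<open>
  Kaplansky's trick: fix \<open>e \<noteq> 0\<close> and transport \<open>star\<close> along the bijections \<open>x \<mapsto> star x e\<close> and
  \<open>y \<mapsto> star e y\<close>. In the new multiplication \<open>star e e\<close> is an identity.
\<close>

lemma isotopic_to_semifield:
  assumes p: "prime p" "\<And>x::'a. prime_field_scale p x = 0"
  shows "\<exists>star' :: 'a \<Rightarrow> 'a \<Rightarrow> 'a. semifield star' \<and> isotopic star star'"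
proof -
  obtain e :: 'a where e: "e \<noteq> 0" using nontrivial by blast
  define f where "f = (\<lambda>x. star x e)"
  define g where "g = (\<lambda>y. star e y)"
  define f' where "f' = inv_into UNIV f"
  define g' where "g' = inv_into UNIV g"
  have bij: "bij f" "bij g" using e by (auto simp: f_def g_def intro: bij_left bij_right)
  have f': "f' (f x) = x" "f (f' x) = x" for x
    using bij by (auto simp: f'_def bij_is_inj bij_is_surj surj_f_inv_f)
  have g': "g' (g x) = x" "g (g' x) = x" for x
    using bij by (auto simp: g'_def bij_is_inj bij_is_surj surj_f_inv_f)
  have add: "additive f" "additive g"
    by (auto simp: f_def g_def additive_left additive_right)
  have add': "additive f'" "additive g'"
    using add bij by (auto simp: f'_def g'_def additive_bij_inverse)
  define star' where "star' = (\<lambda>u v. star (f' u) (g' v))"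
  have "semifield star'"
  proof unfold_locales
    show "star' x (y + z) = star' x y + star' x z" for x y z
      by (simp add: star'_def additive.add[OF add'(2)] distrib_left)
    show "star' (x + y) z = star' x z + star' y z" for x y z
      by (simp add: star'_def additive.add[OF add'(1)] distrib_right)
    show "x = 0 \<or> y = 0" if "star' x y = 0" for x y
    proof -
      have "f' x = 0 \<or> g' y = 0" using that no_zero_divisors by (auto simp: star'_def)
      thus ?thesis using f'(2)[of x] g'(2)[of y] additive.zero[OF add(1)] additive.zero[OF add(2)]
        by auto
    qed
    show "\<exists>x::'a. x \<noteq> 0" by (rule nontrivial)
    have "star e e \<noteq> 0" using no_zero_divisors e by blast
    moreover have "star' (star e e) x = x" for x
      using f'(1)[of e] g'(2)[of x] by (simp add: star'_def f_def g_def)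
    moreover have "star' x (star e e) = x" for x
      using f'(2)[of x] g'(1)[of e] by (simp add: star'_def f_def g_def)
    ultimately show "\<exists>u. u \<noteq> 0 \<and> (\<forall>x. star' u x = x \<and> star' x u = x)" by blast
  qed
  have "additive (id :: 'a \<Rightarrow> 'a)" by (simp add: additive_def)
  moreover have "star' (f x) (g y) = id (star x y)" for x y
    by (simp add: star'_def f'(1) g'(1))
  ultimately have "isotopic star star'" using p bij add
    by (intro isotopicI[of p f g id]) simp_all
  with \<open>semifield star'\<close> show ?thesis by blast
qed

end

section \<open>Powers and subfields in finite fields\<close>

lemma power_eq_self_iff:
  assumes "n > 0"
  shows "z ^ n = z \<longleftrightarrow> z = 0 \<or> z ^ (n - 1) = (1 :: 'a::idom)"
  using assms by (cases n) auto

text \<open>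
  The \<open>m\<close>-th power map sends the nonzero elements to \<open>e\<close>-th roots of unity, and its fibres have at
  most \<open>m\<close> elements, so at least \<open>e\<close> roots are needed to accommodate all \<open>e * m\<close> nonzero elements.
  A polynomial of degree \<open>e\<close> has no more than that.
\<close>

lemma card_roots_of_unity_finite_field:
  fixes e m :: nat
  assumes em: "e * m = CARD('a::finite_field) - 1"
  shows "card {z::'a. z ^ e = 1} = e"
proof -
  have "card {0, 1 :: 'a} \<le> CARD('a)" by (intro card_mono) auto
  hence "CARD('a) > 1" by simp
  with em have pos: "e > 0" "m > 0" by (auto intro!: Nat.gr0I)
  have roots: "card {z::'a. z ^ n = w} \<le> n" if "n > 0" for n w
  proof -
    define p where "p = Polynomial.monom 1 n - [:w:]"
    have "Polynomial.coeff p n = 1" using that by (simp add: p_def coeff_pCons split: nat.splits)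
    hence "p \<noteq> 0" by (metis Polynomial.coeff_0 zero_neq_one)
    moreover have "Polynomial.degree p \<le> n"
      unfolding p_def by (intro degree_diff_le) (auto simp: Polynomial.degree_monom_le)
    moreover have "{z. poly p z = 0} = {z. z ^ n = w}" by (auto simp: p_def poly_monom)
    ultimately show ?thesis using card_poly_roots_bound[of p] by simp
  qed
  have "z ^ (e * m) = 1" if "z \<noteq> 0" for z :: 'a
    using finite_field_power_card_eq_same[of z] \<open>CARD('a) > 1\<close> that
    unfolding em by (simp add: power_eq_self_iff)
  hence sub: "(\<lambda>z. z ^ m) ` (UNIV - {0}) \<subseteq> {z::'a. z ^ e = 1}"
    by (auto simp flip: power_mult simp: mult.commute)
  have "(UNIV - {0 :: 'a}) \<subseteq> (\<Union>w\<in>{z::'a. z ^ e = 1}. {z. z ^ m = w})"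
    using sub by auto
  hence "card (UNIV - {0 :: 'a}) \<le> card (\<Union>w\<in>{z::'a. z ^ e = 1}. {z. z ^ m = w})"
    by (intro card_mono) auto
  also have "\<dots> \<le> (\<Sum>w\<in>{z::'a. z ^ e = 1}. card {z. z ^ m = w})"
    by (intro card_UN_le) auto
  also have "\<dots> \<le> (\<Sum>w\<in>{z::'a. z ^ e = 1}. m)"
    by (intro sum_mono roots pos)
  finally have "e * m \<le> card {z::'a. z ^ e = 1} * m"
    by (simp add: card_Diff_singleton em)
  thus ?thesis using pos roots[of e 1] by simp
qed

lemma minus_one_dvd_power_minus_one:
  assumes "r > 1"
  shows "r - 1 dvd r ^ k - (1::nat)"
proof (induction k)
  case (Suc k)
  obtain m where m: "r ^ k = Suc m" using assms by (cases "r ^ k") auto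
  have "r ^ Suc k - 1 = m * r + (r - 1)" using assms by (simp add: m mult.commute)
  thus ?case using Suc by (simp add: m)
qed simp

lemma card_subfield_of_order:
  assumes "CARD('a::finite_field) = r ^ k" and "r > 1" "k > 0"
  shows "card (subfield_of_order r :: 'a set) = r"
proof -
  have "r - 1 dvd r ^ k - 1" using assms(2) by (rule minus_one_dvd_power_minus_one)
  then obtain m where "(r - 1) * m = CARD('a) - 1" using assms by (metis dvd_def)
  hence "card {z::'a. z ^ (r - 1) = 1} = r - 1" by (rule card_roots_of_unity_finite_field)
  moreover have "subfield_of_order r = insert 0 {z::'a. z ^ (r - 1) = 1}"
    using assms(2) by (auto simp: subfield_of_order_def power_eq_self_iff)
  moreover have "0 \<notin> {z::'a. z ^ (r - 1) = 1}"
    using assms(2) by (simp add: power_0_left)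
  ultimately show ?thesis using assms(2) by simp
qed

section \<open>Frobenius powers\<close>

definition frob :: "nat \<Rightarrow> nat \<Rightarrow> 'a::monoid_mult \<Rightarrow> 'a" where
  "frob q i x = x ^ (q ^ i)"

lemma frob_frob: "frob q i (frob q j x) = frob q (i + j) x"
  by (simp add: frob_def power_add mult.commute flip: power_mult)

lemma frob_mult [simp]: "frob q i (x * y) = frob q i x * frob q i (y :: 'a::comm_monoid_mult)"
  by (simp add: frob_def power_mult_distrib)

lemma frob_1 [simp]: "frob q i 1 = 1"
  by (simp add: frob_def)

lemma frob_eq_self_multiple:
  assumes "frob q i x = x"
  shows "frob q (i * k) x = x"
proof (induction k)
  case (Suc k)
  have "frob q (i * Suc k) x = frob q i (frob q (i * k) x)"
    by (simp add: frob_frob add.commute)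
  thus ?case using Suc assms by simp
qed (simp add: frob_def)

text \<open>
  Bezout: if \<open>i * u = j * v + gcd i j\<close>, then the iterate with exponent \<open>gcd i j\<close> differs from one
  that fixes \<open>x\<close> only by another that fixes \<open>x\<close>.
\<close>

lemma frob_gcd_eq_self:
  assumes "frob q i x = x" "frob q j x = x" "i > 0"
  shows "frob q (gcd i j) x = x"
proof -
  obtain u v where uv: "i * u = j * v + gcd i j"
    using bezout_nat[of i j] assms(3) by auto
  have "x = frob q (gcd i j + j * v) x"
    using frob_eq_self_multiple[OF assms(1), of u] uv by (simp add: add.commute)
  also have "\<dots> = frob q (gcd i j) x"
    using frob_eq_self_multiple[OF assms(2), of v] by (simp flip: frob_frob)
  finally show ?thesis by simp
qed

section \<open>The Budaghyan--Helleseth multiplication\<close>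

locale BH_presemifield =
  fixes q l d :: nat and \<beta> \<omega> :: "'a::finite_field"
  assumes params: "BH_parameters q l d \<beta> \<omega>"
begin

abbreviation bar :: "'a \<Rightarrow> 'a" where "bar \<equiv> frob q l"
abbreviation phi :: "'a \<Rightarrow> 'a" where "phi \<equiv> frob q d"

definition tr :: "'a \<Rightarrow> 'a" where "tr x = x + bar x"

abbreviation form1 :: "'a \<Rightarrow> 'a \<Rightarrow> 'a" where
  "form1 x y \<equiv> tr (x * bar y)"

abbreviation form2 :: "'a \<Rightarrow> 'a \<Rightarrow> 'a" where
  "form2 x y \<equiv> tr (\<beta> * (x * phi y + phi x * y))"

abbreviation mult :: "'a \<Rightarrow> 'a \<Rightarrow> 'a" (infixl "\<star>" 70) where
  "mult \<equiv> BH_mult q l d \<beta> \<omega>"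

lemma card_field: "CARD('a) = q ^ (2 * l)"
  and l_pos: "0 < l" and d_pos: "0 < d" and coprime_l_d: "coprime l d"
  and beta_nonzero: "\<beta> \<noteq> 0"
  and bar_omega: "bar \<omega> = - \<omega>"
  using params by (auto simp: BH_parameters_def frob_def)

lemma no_common_negation:
  assumes "a \<noteq> 0" "bar a = - a" shows "phi a \<noteq> - a"
proof
  assume "phi a = - a"
  hence "a + a ^ (q ^ l) = 0" "a + a ^ (q ^ d) = 0" using assms by (simp_all add: frob_def)
  thus False using params assms(1) unfolding BH_parameters_def by blast
qed

lemma q_gt_1: "q > 1"
  using params primepow_gt_Suc_0 by (auto simp: BH_parameters_def)

lemma omega_nonzero: "\<omega> \<noteq> 0"
  using params q_gt_1 by (auto simp: BH_parameters_def subfield_of_order_def)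

text \<open>
  The parameters only say that \<open>q\<close> is a prime power; its prime is the characteristic because the
  order of the field is a power of \<open>q\<close>. This makes \<open>frob q i\<close> additive.
\<close>

lemma q_eq_CHAR_power: obtains k where "q = CHAR('a) ^ k" "k > 0"
proof -
  obtain p k where pk: "prime p" "k > 0" "q = p ^ k"
    using params by (auto simp: BH_parameters_def primepow_def)
  have "CHAR('a) dvd p ^ (k * (2 * l))"
    using CHAR_dvd_CARD[where 'a = 'a] by (simp add: card_field pk(3) power_mult)
  hence "CHAR('a) dvd p" using prime_dvd_power CHAR_prime by blast
  hence "CHAR('a) = p" using pk(1) CHAR_prime primes_dvd_imp_eq by blast
  thus ?thesis using that pk by blast
qed

lemma two_nonzero [simp]: "(2 :: 'a) \<noteq> 0"
proof
  assume "(2 :: 'a) = 0"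
  hence "of_nat 2 = (0 :: 'a)" by simp
  hence "CHAR('a) dvd 2" using of_nat_eq_0_iff_char_dvd by blast
  hence "CHAR('a) = 2" using CHAR_prime primes_dvd_imp_eq two_is_prime_nat by blast
  moreover obtain k where "q = CHAR('a) ^ k" "k > 0" by (rule q_eq_CHAR_power)
  ultimately show False using params by (simp add: BH_parameters_def)
qed

lemma frob_add [simp]: "frob q i (x + y) = frob q i x + frob q i (y :: 'a)"
proof -
  obtain k where "q = CHAR('a) ^ k" by (rule q_eq_CHAR_power)
  hence "q ^ i = CHAR('a) ^ (k * i)" by (simp add: power_mult)
  thus ?thesis unfolding frob_def by (intro freshmans_dream'[OF CHAR_prime])
qed

lemma additive_frob: "additive (frob q i :: 'a \<Rightarrow> 'a)"
  by standard (rule frob_add)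

lemmas frob_0 [simp] = additive.zero[OF additive_frob]
  and frob_minus [simp] = additive.minus[OF additive_frob]
  and frob_diff [simp] = additive.diff[OF additive_frob]

lemma frob_eq_0_iff [simp]: "frob q i x = 0 \<longleftrightarrow> x = (0 :: 'a)"
  using q_gt_1 by (auto simp: frob_def)

lemma frob_eq_iff: "frob q i x = frob q i y \<longleftrightarrow> x = (y :: 'a)"
  using frob_eq_0_iff[of i "x - y"] by simp

lemma frob_divide [simp]: "frob q i (x / y) = frob q i x / frob q i (y :: 'a)"
  by (simp add: frob_def power_divide)

lemma frob_2 [simp]: "frob q i 2 = (2 :: 'a)"
  using frob_add[of i 1 1] by simp

lemma frob_full [simp]: "frob q (2 * l) x = (x :: 'a)"
  using finite_field_power_card_eq_same[of x] by (simp add: frob_def card_field)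

lemma bar_bar [simp]: "bar (bar x) = x"
  by (simp add: frob_frob flip: mult_2)

lemma bar_phi [simp]: "bar (phi x) = phi (bar x)"
  by (simp add: frob_frob add.commute)

lemma tr_add: "tr (x + y) = tr x + tr y" and tr_diff: "tr (x - y) = tr x - tr y"
  by (simp_all add: tr_def algebra_simps)

lemma tr_0 [simp]: "tr 0 = 0"
  by (simp add: tr_def)

lemma bar_tr [simp]: "bar (tr x) = tr x"
  by (simp add: tr_def add.commute)

lemma tr_bar: "tr (bar x) = tr x"
  by (simp add: tr_def add.commute)

lemma tr_scale: "bar k = k \<Longrightarrow> tr (k * x) = k * tr x"
  by (simp add: tr_def algebra_simps)

lemma tr_of_fixed: "bar u = u \<Longrightarrow> tr u = 2 * u"
  by (simp add: tr_def)

text \<open>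
  Otherwise every element would be a multiple of \<open>x\<close> and have trace \<open>0\<close>; but the trace of \<open>1\<close> is \<open>2\<close>.
\<close>

lemma tr_nondegenerate:
  assumes "\<And>y. tr (x * y) = 0" shows "x = 0"
proof (rule ccontr)
  assume "x \<noteq> 0"
  hence "tr 1 = 0" using assms[of "1 / x"] by simp
  thus False by (simp add: tr_of_fixed)
qed

lemma form1_nondegenerate:
  assumes "\<And>y. form1 x y = form1 x' y" shows "x = x'"
proof -
  have "tr ((x - x') * y) = 0" for y
    using assms[of "bar y"] by (simp add: algebra_simps tr_diff)
  thus ?thesis using tr_nondegenerate[of "x - x'"] by simp
qed

lemma BH_mult_eq: "x \<star> y = form1 x y + form2 x y * \<omega>"
  by (simp add: BH_mult_def frob_def[symmetric] tr_def algebra_simps)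

text \<open>
  The field is the direct sum of the fixed field of \<open>bar\<close> and its multiple by \<open>\<omega>\<close>, on which \<open>bar\<close>
  acts as \<open>1\<close> and \<open>- 1\<close>. Hence an equation between products splits into one for \<open>form1\<close> and one
  for \<open>form2\<close>.
\<close>

lemma decomposition_unique:
  assumes "bar u = u" "bar v = v" "bar u' = u'" "bar v' = v'"
    and "u + v * \<omega> = u' + v' * \<omega>"
  shows "u = u'" "v = v'"
proof -
  have "bar (u + v * \<omega>) = bar (u' + v' * \<omega>)" using assms(5) by simp
  hence "u - v * \<omega> = u' - v' * \<omega>" using assms(1-4) by (simp add: bar_omega)
  hence "(u + v * \<omega>) + (u - v * \<omega>) = (u' + v' * \<omega>) + (u' - v' * \<omega>)"
    using assms(5) by (simp only:)
  hence "2 * u = 2 * u'" by simp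
  thus "u = u'" by simp
  thus "v = v'" using assms(5) omega_nonzero by simp
qed

lemma BH_mult_eq_iff:
  "x \<star> y = x' \<star> y' \<longleftrightarrow> form1 x y = form1 x' y' \<and> form2 x y = form2 x' y'"
  using decomposition_unique[of "form1 x y" "form2 x y" "form1 x' y'" "form2 x' y'"]
  by (auto simp: BH_mult_eq simp del: frob_add frob_mult)

lemma BH_mult_commute: "x \<star> y = y \<star> x"
proof -
  have "form1 x y = form1 y x" using tr_bar[of "x * bar y"] by (simp add: mult.commute)
  thus ?thesis by (simp add: BH_mult_eq algebra_simps)
qed

lemma BH_mult_add_left: "(x + y) \<star> z = x \<star> z + y \<star> z"
  by (simp add: BH_mult_eq algebra_simps tr_add)

lemma BH_mult_scale:
  assumes "frob q 1 c = c"
  shows "(c * x) \<star> y = c * (x \<star> y)"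
proof -
  have c: "bar c = c" "phi c = c"
    using frob_eq_self_multiple[OF assms, of l] frob_eq_self_multiple[OF assms, of d] by auto
  have 1: "form1 (c * x) y = c * form1 x y"
    using tr_scale[OF c(1), of "x * bar y"] by (simp add: mult.assoc)
  have 2: "form2 (c * x) y = c * form2 x y"
    using tr_scale[OF c(1), of "\<beta> * (x * phi y + phi x * y)"] c(2) by (simp add: algebra_simps)
  show ?thesis unfolding BH_mult_eq 1 2 by (simp add: algebra_simps)
qed

text \<open>
  Otherwise \<open>\<beta> * y ^ (q ^ d + 1)\<close> would be a \<open>(q ^ l - 1)\<close>-th root of unity. Raising this relation to the
  power \<open>(q ^ l + 1) div gcd (q ^ l + 1) (q ^ d + 1)\<close> makes the exponent of \<open>y\<close> a multiple of
  \<open>q ^ (2 * l) - 1\<close>, and what remains contradicts the condition on \<open>\<beta>\<close>.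
\<close>

lemma no_fixed_beta_multiple:
  assumes "y \<noteq> 0"
  shows "bar (\<beta> * (y * phi y)) \<noteq> \<beta> * (y * phi y)"
proof
  let ?g = "gcd (q ^ l + 1) (q ^ d + 1)"
  define z where "z = \<beta> * y ^ (q ^ d + 1)"
  assume "bar (\<beta> * (y * phi y)) = \<beta> * (y * phi y)"
  hence "z ^ (q ^ l) = z" by (simp add: z_def frob_def)
  moreover have "z \<noteq> 0" using assms beta_nonzero by (simp add: z_def)
  moreover have "q ^ l > 0" using q_gt_1 by simp
  ultimately have z1: "z ^ (q ^ l - 1) = 1" by (simp add: power_eq_self_iff)
  have y1: "y ^ (q ^ (2 * l) - 1) = 1"
    using finite_field_power_card_eq_same[of y] assms q_gt_1
    by (simp add: power_eq_self_iff card_field)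
  obtain s where s: "q ^ l + 1 = ?g * s" by (meson dvd_def gcd_dvd1)
  obtain t where t: "q ^ d + 1 = ?g * t" by (meson dvd_def gcd_dvd2)
  have g: "?g > 0" by simp
  have fac: "q ^ (2 * l) - 1 = (q ^ l - 1) * (q ^ l + 1)"
    by (simp only: mult_2 power_add) (simp add: algebra_simps)
  hence quot: "(q ^ (2 * l) - 1) div ?g = (q ^ l - 1) * s"
    using s g by (metis mult.left_commute nonzero_mult_div_cancel_left less_numeral_extra(3))
  have "(q ^ d + 1) * ((q ^ l - 1) * s) = (q ^ (2 * l) - 1) * t"
    unfolding fac by (subst t, subst s) (simp only: ac_simps)
  hence "(y ^ (q ^ d + 1)) ^ ((q ^ l - 1) * s) = 1"
    using y1 by (metis power_mult power_one)
  moreover have "z ^ ((q ^ l - 1) * s) = 1" using z1 by (simp add: power_mult)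
  ultimately have "\<beta> ^ ((q ^ l - 1) * s) = 1" by (simp add: z_def power_mult_distrib)
  thus False using params quot by (simp add: BH_parameters_def)
qed

text \<open>
  Write \<open>x = a * y\<close>. Vanishing of \<open>form1\<close> means \<open>bar a = - a\<close>; then \<open>b = a + phi a\<close> satisfies
  \<open>bar b = - b\<close> as well and is nonzero, and vanishing of \<open>form2\<close> says that \<open>\<beta> * (y * phi y)\<close> is
  fixed by \<open>bar\<close>.
\<close>

lemma no_zero_divisors:
  assumes "x \<star> y = 0"
  shows "x = 0 \<or> y = 0"
proof (rule ccontr)
  assume xy: "\<not> (x = 0 \<or> y = 0)"
  have "0 \<star> y = 0" by (simp add: BH_mult_eq)
  hence f: "form1 x y = 0" "form2 x y = 0"
    using assms BH_mult_eq_iff[of x y 0 y] by auto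
  define a where "a = x / y"
  have x: "x = a * y" and a: "a \<noteq> 0" using xy by (auto simp: a_def)
  have "form1 x y = (y * bar y) * tr a"
    using tr_scale[of "y * bar y" a] by (simp add: x algebra_simps)
  hence "tr a = 0" using f xy by simp
  hence bar_a: "bar a = - a" by (simp add: tr_def eq_neg_iff_add_eq_0 add.commute)
  define b where "b = a + phi a"
  have b: "b \<noteq> 0"
    using no_common_negation[OF a bar_a] by (auto simp: b_def eq_neg_iff_add_eq_0 add.commute)
  have "phi (- a) = - phi a" by simp
  hence bar_b: "bar b = - b" by (simp add: b_def bar_a)
  have "form2 x y = tr (b * (\<beta> * (y * phi y)))"
    by (simp add: x b_def algebra_simps)
  also have "\<dots> = b * (\<beta> * (y * phi y) - bar (\<beta> * (y * phi y)))"
    by (simp only: tr_def frob_mult[of q l b] bar_b) (simp add: algebra_simps)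
  finally show False using f b no_fixed_beta_multiple[of y] xy by simp
qed

lemma presemifield_BH: "presemifield mult"
proof
  show "x \<star> (y + z) = x \<star> y + x \<star> z" for x y z
    by (simp add: BH_mult_commute[of x] BH_mult_add_left)
  show "\<exists>x::'a. x \<noteq> 0" by (rule exI[of _ 1]) simp
qed (auto simp: BH_mult_add_left dest: no_zero_divisors)

section \<open>The two solution sets behind the middle nucleus\<close>

text \<open>
  If \<open>l\<close> and \<open>d\<close> were both odd, an element with \<open>a ^ q = - a\<close> would be negated by \<open>bar\<close> and by
  \<open>phi\<close>. A suitable power of \<open>\<omega>\<close> is such an element, since \<open>\<omega> ^ (q ^ l - 1) = - 1\<close> and \<open>q - 1\<close>
  divides \<open>q ^ l - 1\<close>.
\<close>

lemma odd_l_plus_d: "odd (l + d)"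
proof
  assume "even (l + d)"
  hence odd: "odd l" "odd d" using coprime_common_divisor[OF coprime_l_d, of 2] by auto
  have "q - 1 dvd q ^ l - 1" using q_gt_1 by (rule minus_one_dvd_power_minus_one)
  then obtain s where s: "q ^ l - 1 = (q - 1) * s" by auto
  define a where "a = \<omega> ^ s"
  have a: "a \<noteq> 0" using omega_nonzero by (simp add: a_def)
  have "\<omega> * \<omega> ^ (q ^ l - 1) = - \<omega>"
    using bar_omega q_gt_1 by (simp add: frob_def power_Suc[symmetric] del: power_Suc)
  hence "\<omega> ^ (q ^ l - 1) = - 1" using omega_nonzero
    by (metis mult_left_cancel mult_minus1_right)
  moreover have "a ^ (q - 1) = \<omega> ^ (q ^ l - 1)"
    unfolding s a_def by (simp only: power_mult[symmetric] mult.commute)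
  ultimately have "a ^ (q - 1) = - 1" by simp
  hence "a * a ^ (q - 1) = - a" by simp
  hence fa: "frob q 1 a = - a"
    using q_gt_1 by (simp add: frob_def power_Suc[symmetric] del: power_Suc)
  have "frob q i a = (if even i then a else - a)" for i
  proof (induction i)
    case (Suc i)
    have "frob q (Suc i) a = frob q 1 (frob q i a)" by (simp add: frob_frob)
    thus ?case using Suc fa by simp
  qed (simp add: frob_def)
  thus False using odd no_common_negation[OF a] by simp
qed

lemma coprime_l_plus_d: "coprime (l + d) (2 * l)"
proof -
  have "coprime (l + d) 2" using odd_l_plus_d by simp
  moreover have "coprime (l + d) l"
    using coprime_imp_gcd_eq_1[OF coprime_l_d]
    by (intro gcd_eq_1_imp_coprime) (simp add: gcd.commute)
  ultimately show ?thesis by simp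
qed

definition fixed_q :: "'a set" where "fixed_q = {a. frob q 1 a = a}"

text \<open>
  Applying \<open>bar\<close> to \<open>phi a = bar a\<close> shows that \<open>a\<close> is fixed by the iterate \<open>l + d\<close> of the
  \<open>q\<close>-power map, as it is by the iterate \<open>2 * l\<close>, and these numbers are coprime.
\<close>

lemma fixed_q_iff: "a \<in> fixed_q \<longleftrightarrow> phi a = bar a"
proof
  assume "a \<in> fixed_q"
  thus "phi a = bar a"
    using frob_eq_self_multiple[of q 1 a l] frob_eq_self_multiple[of q 1 a d]
    by (simp add: fixed_q_def)
next
  assume *: "phi a = bar a"
  have "frob q (l + d) a = bar (phi a)" by (simp add: frob_frob)
  hence "frob q (l + d) a = a" using * by simp
  from frob_gcd_eq_self[OF this, of "2 * l"] show "a \<in> fixed_q"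
    using coprime_imp_gcd_eq_1[OF coprime_l_plus_d] l_pos by (simp add: fixed_q_def)
qed

lemma fixed_q_if: "bar a = a \<Longrightarrow> phi a = a \<Longrightarrow> a \<in> fixed_q"
  by (simp only: fixed_q_iff)

lemma card_frob_fixed:
  assumes "i > 0" "i dvd 2 * l"
  shows "card {a::'a. frob q i a = a} = q ^ i"
proof -
  obtain k where k: "2 * l = i * k" using assms(2) by auto
  have "card (subfield_of_order (q ^ i) :: 'a set) = q ^ i"
  proof (rule card_subfield_of_order)
    show "CARD('a) = (q ^ i) ^ k" by (simp add: card_field k power_mult)
    show "q ^ i > 1" using q_gt_1 assms(1) by (rule one_less_power)
    show "k > 0" using k l_pos by (auto intro: Nat.gr0I)
  qed
  thus ?thesis by (simp add: subfield_of_order_def frob_def)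
qed

lemma card_fixed_q: "card fixed_q = q"
  using card_frob_fixed[of 1] by (simp add: fixed_q_def)

text \<open>
  The coefficients \<open>b\<close> for which the map \<open>x \<mapsto> b * bar x\<close> takes part in the middle nucleus.
\<close>

definition mid_twists :: "'a set" where
  "mid_twists = {b. \<beta> * phi b = bar \<beta> * bar b}"

text \<open>
  With \<open>m = l + d\<close> and \<open>y = bar x\<close>, the equation for \<open>x\<close> becomes \<open>\<beta> * frob q m y = bar \<beta> * y\<close>, where
  \<open>bar \<beta> / \<beta> = c ^ (q - 1)\<close> for a power \<open>c\<close> of \<open>\<beta>\<close>. Since \<open>m\<close> is coprime to \<open>2 * l\<close>, the \<open>q\<close>-power map
  is an iterate of \<open>frob q m\<close>, say the \<open>u\<close>-th. The product of the first \<open>u\<close> iterates of \<open>frob q m\<close> at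
  \<open>c\<close> is then a solution, because \<open>frob q m\<close> turns its factor \<open>c\<close> into \<open>c ^ q\<close>.
\<close>

lemma ex_mid_twist: "\<exists>b\<in>mid_twists. b \<noteq> 0"
proof -
  have "q - 1 dvd q ^ l - 1" using q_gt_1 by (rule minus_one_dvd_power_minus_one)
  then obtain s where s: "q ^ l - 1 = (q - 1) * s" by auto
  define c where "c = \<beta> ^ s"
  have c: "c \<noteq> 0" using beta_nonzero by (simp add: c_def)
  have "c ^ (q - 1) = \<beta> ^ (q ^ l - 1)"
    unfolding s c_def by (simp only: power_mult[symmetric] mult.commute)
  hence "c * (\<beta> * \<beta> ^ (q ^ l - 1)) = \<beta> * (c * c ^ (q - 1))"
    by (simp only: mult_ac)
  hence beta_c: "c * bar \<beta> = \<beta> * frob q 1 c"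
    using q_gt_1 by (simp add: frob_def power_Suc[symmetric] del: power_Suc)
  define m where "m = l + d"
  obtain u v where uv: "m * u = 2 * l * v + 1"
    using bezout_nat[of m "2 * l"] coprime_imp_gcd_eq_1[OF coprime_l_plus_d] l_pos
    by (auto simp: m_def)
  define b where "b = (\<Prod>i<u. frob q (m * i) c)"
  have b: "b \<noteq> 0" using c by (simp add: b_def)
  have frob_prod: "frob q i (\<Prod>j\<in>J. f j) = (\<Prod>j\<in>J. frob q i (f j))" for i J and f :: "nat \<Rightarrow> 'a"
    by (simp add: frob_def prod_power_distrib)
  have "c * frob q m b = c * (\<Prod>i<u. frob q (m * Suc i) c)"
    by (simp add: b_def frob_prod frob_frob)
  also have "\<dots> = (\<Prod>i<Suc u. frob q (m * i) c)"
    by (subst prod.lessThan_Suc_shift) (simp add: frob_def)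
  also have "\<dots> = b * frob q (m * u) c" by (simp add: b_def)
  also have "frob q (m * u) c = frob q 1 (frob q (2 * l * v) c)"
    by (simp add: uv frob_frob add.commute)
  also have "frob q (2 * l * v) c = c"
    by (rule frob_eq_self_multiple) simp
  finally have step: "c * frob q m b = b * frob q 1 c" .
  have "c * (\<beta> * frob q m b) = b * (\<beta> * frob q 1 c)" using step by (simp add: mult_ac)
  hence "c * (\<beta> * frob q m b) = c * (bar \<beta> * b)"
    by (simp only: beta_c[symmetric] mult_ac)
  hence "\<beta> * frob q m b = bar \<beta> * b" using c by simp
  moreover have "frob q m b = phi (bar b)" by (simp add: m_def frob_frob add.commute)
  ultimately have "bar b \<in> mid_twists" by (simp add: mid_twists_def)
  thus ?thesis using b by (intro bexI[of _ "bar b"]) auto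
qed

lemma card_mid_twists: "card mid_twists = q"
proof -
  obtain b where b: "b \<in> mid_twists" "b \<noteq> 0" using ex_mid_twist by blast
  have "mid_twists = (\<lambda>a. a * b) ` fixed_q"
  proof (intro equalityI subsetI)
    fix x assume x: "x \<in> mid_twists"
    define a where "a = x / b"
    have "\<beta> * phi b * phi a = bar \<beta> * bar b * bar a"
      using x b(2) by (simp add: a_def mid_twists_def)
    hence "phi a = bar a" using b beta_nonzero by (simp add: mid_twists_def)
    hence "a \<in> fixed_q" by (simp only: fixed_q_iff)
    thus "x \<in> (\<lambda>a. a * b) ` fixed_q" using b(2) by (intro image_eqI[of _ _ a]) (auto simp: a_def)
  next
    fix x assume "x \<in> (\<lambda>a. a * b) ` fixed_q"
    then obtain a where "x = a * b" "phi a = bar a" using fixed_q_iff by blast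
    thus "x \<in> mid_twists" using b(1) by (simp add: mid_twists_def algebra_simps)
  qed
  moreover have "inj_on (\<lambda>a. a * b) fixed_q" using b(2) by (auto intro: inj_onI)
  ultimately show ?thesis by (simp only: card_image card_fixed_q)
qed

section \<open>The middle nucleus\<close>

definition bar_linear :: "('a \<Rightarrow> 'a) \<Rightarrow> bool" where
  "bar_linear A \<longleftrightarrow> (\<forall>x y. A (x + y) = A x + A y) \<and> (\<forall>k x. bar k = k \<longrightarrow> A (k * x) = k * A x)"

text \<open>
  The form \<open>form1\<close> is linear over the fixed field of \<open>bar\<close> in its first argument and nondegenerate,
  so a map that has an adjoint inherits linearity.
\<close>

lemma bar_linear_if_form1_adjoint:
  assumes adj: "\<And>x y. form1 (A x) y = form1 x (B y)"
  shows "bar_linear A"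
  unfolding bar_linear_def
proof (intro conjI allI impI)
  fix x y
  show "A (x + y) = A x + A y"
  proof (rule form1_nondegenerate)
    fix z
    have "form1 (A (x + y)) z = form1 (A x) z + form1 (A y) z"
      by (simp add: adj algebra_simps tr_add)
    thus "form1 (A (x + y)) z = form1 (A x + A y) z" by (simp add: algebra_simps tr_add)
  qed
next
  fix k x assume k: "bar k = k"
  show "A (k * x) = k * A x"
  proof (rule form1_nondegenerate)
    fix z
    have "form1 (A (k * x)) z = k * form1 (A x) z"
      using tr_scale[OF k, of "x * bar (B z)"] by (simp only: adj mult.assoc)
    thus "form1 (A (k * x)) z = form1 (k * A x) z"
      using tr_scale[OF k, of "A x * bar z"] by (simp only: mult.assoc)
  qed
qed

text \<open>
  The field has the basis \<open>1, \<omega>\<close> over the fixed field of \<open>bar\<close>; \<open>a\<close> and \<open>b\<close> are found by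
  solving \<open>A 1 = a + b\<close> and \<open>A \<omega> = (a - b) * \<omega>\<close>.
\<close>

lemma bar_linear_form:
  assumes "bar_linear A"
  obtains a b where "\<And>x. A x = a * x + b * bar x"
proof -
  define a where "a = (A 1 + A \<omega> / \<omega>) / 2"
  define b where "b = (A 1 - A \<omega> / \<omega>) / 2"
  have "A x = a * x + b * bar x" for x
  proof -
    define u where "u = (x + bar x) / 2"
    define v where "v = (x - bar x) / (2 * \<omega>)"
    have u: "bar u = u" and v: "bar v = v"
      by (simp_all add: u_def v_def bar_omega add.commute minus_divide_right[symmetric] minus_divide_left)
    have "u + v * \<omega> = ((x + bar x) + (x - bar x)) / 2"
      using omega_nonzero unfolding u_def v_def by (simp only: add_divide_distrib) simp
    hence x: "x = u * 1 + v * \<omega>" by simp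
    hence bx: "bar x = u - v * \<omega>" using u v bar_omega by simp
    have "A x = u * A 1 + v * A \<omega>"
      using assms u v unfolding bar_linear_def by (subst x) metis
    moreover have "(4::'a) \<noteq> 0"
      using two_nonzero by (metis mult_2 numeral_Bit0 mult_eq_0_iff)
    hence "A 1 = a + b" "A \<omega> = (a - b) * \<omega>"
      using omega_nonzero by (simp_all add: a_def b_def field_simps)
    ultimately show ?thesis by (simp add: bx x[symmetric]) (subst x, simp add: bx algebra_simps)
  qed
  thus ?thesis using that by blast
qed

text \<open>
  A general linear map over the fixed field of \<open>bar\<close> and its adjoint with respect to \<open>form1\<close>.
\<close>

definition mid_left :: "'a \<Rightarrow> 'a \<Rightarrow> 'a \<Rightarrow> 'a" where
  "mid_left a b = (\<lambda>x. a * x + b * bar x)"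

definition mid_right :: "'a \<Rightarrow> 'a \<Rightarrow> 'a \<Rightarrow> 'a" where
  "mid_right a b = (\<lambda>x. bar a * x + b * bar x)"

lemma form1_mid: "form1 (mid_left a b x) y = form1 x (mid_right a b y)"
proof -
  have "tr (b * bar x * bar y) = tr (bar b * x * y)"
    using tr_bar[of "bar b * x * y"] by simp
  thus ?thesis by (simp add: mid_left_def mid_right_def algebra_simps tr_add)
qed

lemma form2_mid:
  assumes a: "phi a = bar a" and b: "\<beta> * phi b = bar \<beta> * bar b"
  shows "form2 (mid_left a b x) y = form2 x (mid_right a b y)"
proof -
  have pba: "phi (bar a) = a" using arg_cong[OF a, of bar] by simp
  have b': "\<beta> * b = bar \<beta> * phi (bar b)" using arg_cong[OF b, of bar] by simp
  define p where "p = \<beta> * a * x * phi y + \<beta> * bar a * phi x * y"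
  define r where "r = \<beta> * phi b * x * phi (bar y) + \<beta> * b * phi x * bar y"
  have "\<beta> * (mid_left a b x * phi y + phi (mid_left a b x) * y)
      = p + ((\<beta> * b) * bar x * phi y + (\<beta> * phi b) * phi (bar x) * y)"
    by (simp add: mid_left_def p_def a algebra_simps)
  also have "\<dots> = p + bar r"
    by (simp add: r_def b b')
  finally have L: "\<beta> * (mid_left a b x * phi y + phi (mid_left a b x) * y) = p + bar r" .
  have R: "\<beta> * (x * phi (mid_right a b y) + phi x * mid_right a b y) = p + r"
    by (simp add: mid_right_def p_def r_def pba algebra_simps)
  show ?thesis unfolding L R tr_add tr_bar ..
qed

text \<open>
  The elements fixed by both maps form the field with \<open>q\<close> elements, which is smaller than the fixed
  field of \<open>bar\<close>, of order \<open>q ^ l\<close>.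
\<close>

lemma ex_bar_fixed_not_phi_fixed:
  assumes "l > 1"
  obtains k where "bar k = k" "phi k \<noteq> k"
proof (rule ccontr)
  assume "\<not> thesis"
  hence "{k::'a. frob q l k = k} \<subseteq> fixed_q" using that fixed_q_if by blast
  hence "card {k::'a. frob q l k = k} \<le> card fixed_q" by (intro card_mono) auto
  hence "q ^ l \<le> q ^ 1" using card_frob_fixed[of l] card_fixed_q l_pos by simp
  thus False using q_gt_1 assms by (simp only: power_increasing_iff)
qed

text \<open>
  Collecting terms under the trace, adjointness reads \<open>tr (f x * y) = tr (g x * phi y)\<close> with \<open>f\<close> and
  \<open>g\<close> as below. Scaling \<open>y\<close> by an element \<open>k\<close> fixed by \<open>bar\<close> multiplies the left-hand side by \<open>k\<close>
  and the right-hand side by \<open>phi k\<close>, so both vanish and \<open>f = 0\<close>. Evaluating \<open>f\<close> at \<open>1\<close> and at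
  \<open>\<omega>\<close> gives the two equations.
\<close>

lemma form2_mid_imp:
  assumes "l > 1"
    and adj: "\<And>x y. form2 (mid_left a b x) y = form2 x (mid_right a b y)"
  shows "phi a = bar a" "\<beta> * phi b = bar \<beta> * bar b"
proof -
  define s where "s = phi a - bar a"
  define t where "t = \<beta> * phi b - bar \<beta> * bar b"
  define f where "f = (\<lambda>x. \<beta> * s * phi x + t * phi (bar x))"
  define g where "g = (\<lambda>x. \<beta> * bar s * x + bar t * bar x)"
  have fg: "tr (f x * y) = tr (g x * phi y)" for x y
  proof -
    have "tr (\<beta> * (mid_left a b x * phi y + phi (mid_left a b x) * y)) -
        tr (\<beta> * (x * phi (mid_right a b y) + phi x * mid_right a b y)) = 0"
      by (simp only: adj right_minus_eq)
    moreover have "tr (f x * y) - tr (g x * phi y) =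
        tr (\<beta> * (mid_left a b x * phi y + phi (mid_left a b x) * y)) -
        tr (\<beta> * (x * phi (mid_right a b y) + phi x * mid_right a b y))"
      unfolding tr_def f_def g_def s_def t_def mid_left_def mid_right_def
      by (simp add: algebra_simps)
    ultimately show ?thesis by simp
  qed
  obtain k where k: "bar k = k" "phi k \<noteq> k" using assms(1) by (rule ex_bar_fixed_not_phi_fixed)
  have k': "bar (phi k) = phi k" using k by simp
  have f0: "f x = 0" for x
  proof (rule tr_nondegenerate)
    fix y
    have "k * tr (f x * y) = tr (f x * (k * y))"
      using tr_scale[OF k(1), of "f x * y"] by (simp add: mult_ac)
    also have "\<dots> = tr (g x * phi (k * y))" by (rule fg)
    also have "\<dots> = tr (phi k * (g x * phi y))" by (simp add: mult_ac)
    also have "\<dots> = phi k * tr (f x * y)" by (simp only: tr_scale[OF k'] fg)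
    finally show "tr (f x * y) = 0" using k(2) by simp
  qed
  have "\<beta> * s + t = 0" using f0[of 1] by (simp add: f_def)
  moreover have "(\<beta> * s - t) * phi \<omega> = 0"
    using f0[of \<omega>] by (simp add: f_def bar_omega algebra_simps)
  hence "\<beta> * s = t" using omega_nonzero by simp
  ultimately have "2 * t = 0" by simp
  hence "t = 0" "s = 0" using \<open>\<beta> * s = t\<close> beta_nonzero by simp_all
  thus "phi a = bar a" "\<beta> * phi b = bar \<beta> * bar b" by (simp_all add: s_def t_def)
qed

lemma middle_pairs_BH:
  assumes "l > 1"
  shows "middle_pairs mult = (\<lambda>(a, b). (mid_left a b, mid_right a b)) ` (fixed_q \<times> mid_twists)"
proof (intro equalityI subsetI)
  fix p assume "p \<in> middle_pairs mult"
  then obtain A B where p: "p = (A, B)" and AB: "\<And>x y. A x \<star> y = x \<star> B y"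
    by (auto simp: middle_pairs_def)
  have f1: "form1 (A x) y = form1 x (B y)" and f2: "form2 (A x) y = form2 x (B y)" for x y
    using AB[of x y] by (simp_all only: BH_mult_eq_iff)
  have "bar_linear A" using f1 by (rule bar_linear_if_form1_adjoint)
  then obtain a b where "\<And>x. A x = a * x + b * bar x" using bar_linear_form by blast
  hence A: "A = mid_left a b" by (simp add: mid_left_def fun_eq_iff)
  have "B = mid_right a b"
  proof
    fix y
    have "form1 (B y) x = form1 (mid_right a b y) x" for x
    proof -
      have "form1 x (B y) = form1 x (mid_right a b y)"
        by (simp only: f1[symmetric] A form1_mid)
      thus ?thesis using tr_bar[of "x * bar (B y)"] tr_bar[of "x * bar (mid_right a b y)"]
        by (simp add: mult.commute)
    qed
    thus "B y = mid_right a b y" by (rule form1_nondegenerate)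
  qed
  moreover from this have "form2 (mid_left a b x) y = form2 x (mid_right a b y)" for x y
    using f2 A by simp
  hence "a \<in> fixed_q" "b \<in> mid_twists"
    using form2_mid_imp[OF assms, of a b] by (simp_all only: fixed_q_iff mid_twists_def mem_Collect_eq)
  ultimately have "(a, b) \<in> fixed_q \<times> mid_twists" "p = (\<lambda>(a, b). (mid_left a b, mid_right a b)) (a, b)"
    by (simp_all add: p A)
  thus "p \<in> (\<lambda>(a, b). (mid_left a b, mid_right a b)) ` (fixed_q \<times> mid_twists)"
    by (rule rev_image_eqI)
next
  fix p assume "p \<in> (\<lambda>(a, b). (mid_left a b, mid_right a b)) ` (fixed_q \<times> mid_twists)"
  then obtain a b where p: "p = (mid_left a b, mid_right a b)"
    and ab: "a \<in> fixed_q" "b \<in> mid_twists" by auto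
  have "phi a = bar a" "\<beta> * phi b = bar \<beta> * bar b"
    using ab by (simp_all only: fixed_q_iff mid_twists_def mem_Collect_eq)
  hence "mid_left a b x \<star> y = x \<star> mid_right a b y" for x y
    by (simp only: BH_mult_eq_iff form1_mid form2_mid simp_thms)
  thus "p \<in> middle_pairs mult" by (simp add: p middle_pairs_def)
qed

lemma card_middle_pairs_BH:
  assumes "l > 1"
  shows "card (middle_pairs mult) = q ^ 2"
proof -
  have eqs: "a = a' \<and> b = b'" if "mid_left a b = mid_left a' b'" for a b a' b'
  proof -
    have "a + b = a' + b'" using fun_cong[OF that, of 1] by (simp add: mid_left_def)
    moreover have "(a - b) * \<omega> = (a' - b') * \<omega>"
      using fun_cong[OF that, of \<omega>] by (simp add: mid_left_def bar_omega algebra_simps)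
    hence "a - b = a' - b'" using omega_nonzero by simp
    ultimately have "(a + b) + (a - b) = (a' + b') + (a' - b')" by (simp only:)
    hence "2 * a = 2 * a'" by simp
    thus ?thesis using \<open>a + b = a' + b'\<close> by simp
  qed
  have "inj_on (\<lambda>(a, b). (mid_left a b, mid_right a b)) (fixed_q \<times> mid_twists)"
    by (rule inj_onI) (clarsimp dest!: eqs)
  hence "card (middle_pairs mult) = card (fixed_q \<times> mid_twists)"
    by (simp only: middle_pairs_BH[OF assms] card_image)
  thus ?thesis by (simp only: card_cartesian_product card_fixed_q card_mid_twists power2_eq_square)
qed

section \<open>The left and right nucleus and the center\<close>

text \<open>
  The hypothesis says \<open>G (w * phi y) = G (phi w * y)\<close>. Replacing \<open>w\<close> by \<open>w / phi y\<close> yields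
  \<open>G w = G (phi w * (y / phi (phi y)))\<close> for every \<open>y \<noteq> 0\<close>. Comparing \<open>y = 1\<close> with a \<open>y\<close> such that
  \<open>phi (phi y) \<noteq> y\<close> shows that \<open>G\<close> vanishes on all multiples of a nonzero element. Such a \<open>y\<close> exists
  because \<open>phi \<circ> phi\<close> fixes only \<open>q ^ 2\<close> elements.
\<close>

lemma additive_vanishing_on_alternating:
  assumes "l > 1" and G: "additive (G :: 'a \<Rightarrow> 'b::ab_group_add)"
    and alt: "\<And>x y. G (x * phi y - phi x * y) = 0"
  shows "G z = 0"
proof -
  have "\<exists>y::'a. frob q (2 * d) y \<noteq> y"
  proof (rule ccontr)
    assume "\<not> ?thesis"
    hence "frob q (gcd (2 * d) (2 * l)) y = y" for y :: 'a
      using d_pos by (intro frob_gcd_eq_self) auto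
    moreover have "gcd (2 * d) (2 * l) = 2"
      using coprime_imp_gcd_eq_1[OF coprime_l_d]
      by (simp add: gcd.commute flip: gcd_mult_distrib_nat)
    ultimately have "{y::'a. frob q 2 y = y} = UNIV" by auto
    hence "q ^ (2 * l) = q ^ 2" using card_frob_fixed[of 2] by (simp add: card_field)
    thus False using q_gt_1 assms(1) by simp
  qed
  then obtain y :: 'a where y: "phi (phi y) \<noteq> y" by (auto simp: frob_frob mult_2)
  have y0: "y \<noteq> 0" using y by auto
  have swap: "G (w * phi y) = G (phi w * y)" for w y
    using alt[of w y] by (simp add: additive.diff[OF G])
  define r where "r = y / phi (phi y)"
  have r: "r \<noteq> 1" "r \<noteq> 0" using y y0 by (auto simp: r_def)
  have G1: "G w = G (phi w)" for w using swap[of w 1] by simp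
  have "G w = G (phi w * r)" for w
    using swap[of "w / phi y" y] y0 by (simp add: r_def)
  hence "G (phi w * r) - G (phi w) = 0" for w using G1[of w] by simp
  hence Gr: "G (phi w * (r - 1)) = 0" for w
    by (simp add: additive.diff[OF G] right_diff_distrib)
  have "surj phi" by (intro finite_UNIV_inj_surj injI) (simp_all add: frob_eq_iff)
  then obtain w where "z / (r - 1) = phi w" by (rule surjE)
  hence "phi w * (r - 1) = z" using r by (simp add: field_simps)
  thus ?thesis using Gr[of w] by simp
qed

text \<open>
  Moving a factor \<open>k\<close> fixed by \<open>bar\<close> from one argument to the other does not change \<open>form1\<close>, and it
  changes \<open>form2\<close> by an alternating expression, to which the preceding lemma applies.
\<close>

lemma form2_swap_scale:
  assumes "bar k = k"
  shows "(k * x) \<star> y - x \<star> (k * y) = tr (\<beta> * (k - phi k) * (x * phi y - phi x * y)) * \<omega>"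
proof -
  have "(k * x) \<star> y - x \<star> (k * y) = (form2 (k * x) y - form2 x (k * y)) * \<omega>"
    using assms by (simp add: BH_mult_eq algebra_simps)
  also have "form2 (k * x) y - form2 x (k * y) =
      tr (\<beta> * (k - phi k) * (x * phi y - phi x * y))"
    by (simp add: algebra_simps flip: tr_diff)
  finally show ?thesis .
qed

lemma fixed_q_scalars:
  assumes "c \<in> fixed_q"
  shows "(c * x) \<star> y = c * (x \<star> y)" "x \<star> (c * y) = c * (x \<star> y)"
  using assms by (simp_all add: fixed_q_def BH_mult_scale BH_mult_commute[of x])

text \<open>
  Since \<open>form1 (A x) y\<close> is half the trace of \<open>C (x \<star> y)\<close>, it is determined by \<open>form1 x y\<close> and
  \<open>form2 x y\<close>. As \<open>A\<close> is linear over the fixed field of \<open>bar\<close>, a factor \<open>k\<close> from that field can be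
  moved between \<open>x\<close> and \<open>y\<close> without changing this trace, whereas \<open>form2 x y\<close> changes by a trace of
  alternating expressions; so \<open>tr \<circ> C\<close> vanishes on \<open>w * \<omega>\<close> for all \<open>w\<close> fixed by \<open>bar\<close>, by
  \<open>additive_vanishing_on_alternating\<close>. What remains says that
  \<open>form1 (A x) y\<close> is \<open>c * form1 x y\<close> for a constant \<open>c\<close>, and nondegeneracy gives \<open>A x = c * x\<close>.
  Finally \<open>(c * x) \<star> y = x \<star> (c * y)\<close> is only possible if \<open>phi c = c\<close>.
\<close>

lemma left_pair_BH:
  assumes "l > 1" and AC: "\<And>x y. A x \<star> y = C (x \<star> y)"
  shows "\<exists>c\<in>fixed_q. A = (\<lambda>x. c * x) \<and> C = (\<lambda>x. c * x)"
proof -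
  interpret BH: presemifield mult by (rule presemifield_BH)
  have "A x \<star> y = x \<star> A y" for x y
    using AC[of x y] AC[of y x] by (simp add: BH_mult_commute)
  hence "form1 (A x) y = form1 x (A y)" for x y by (simp only: BH_mult_eq_iff)
  hence "bar_linear A" by (rule bar_linear_if_form1_adjoint)
  hence A_add: "A (x + y) = A x + A y" and A_scale: "bar k = k \<Longrightarrow> A (k * x) = k * A x" for x y k
    by (auto simp: bar_linear_def)
  have times_1: "\<exists>x. z = x \<star> 1" for z
    using BH.bij_left[of 1] by (auto dest!: bij_is_surj)
  have C_add: "additive C"
  proof
    fix u v
    obtain x y where "u = x \<star> 1" "v = y \<star> 1" using times_1 by blast
    thus "C (u + v) = C u + C v"
      by (simp add: AC[symmetric] BH_mult_add_left[symmetric] A_add)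
  qed
  have tr_mult: "tr (x \<star> y) = 2 * form1 x y" for x y
    by (simp add: BH_mult_eq tr_add tr_of_fixed tr_scale) (simp add: tr_def bar_omega)
  have tr_C: "tr (C (x \<star> y)) = 2 * form1 (A x) y" for x y
    by (simp only: AC[symmetric] tr_mult)

  have C_omega: "tr (C (w * \<omega>)) = 0" if w: "bar w = w" for w
  proof -
    obtain k where k: "bar k = k" "phi k \<noteq> k"
      using assms(1) by (rule ex_bar_fixed_not_phi_fixed)
    define G where "G = (\<lambda>z. tr (C (tr (\<beta> * (k - phi k) * z) * \<omega>)))"
    have "additive G"
      by standard (simp only: G_def distrib_left distrib_right tr_add additive.add[OF C_add])
    moreover have "G (x * phi y - phi x * y) = 0" for x y
    proof -
      have "G (x * phi y - phi x * y) = tr (C ((k * x) \<star> y)) - tr (C (x \<star> (k * y)))"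
        by (simp only: G_def form2_swap_scale[OF k(1), symmetric] additive.diff[OF C_add] tr_diff)
      also have "\<dots> = 0"
        using k(1) by (simp add: tr_C A_scale mult_ac)
      finally show ?thesis .
    qed
    ultimately have "G (w / (2 * (\<beta> * (k - phi k)))) = 0"
      by (rule additive_vanishing_on_alternating[OF assms(1)])
    \<comment> \<open>The trace doubles elements fixed by \<open>bar\<close>, so this argument of \<open>G\<close> produces \<open>w * \<omega>\<close> under \<open>C\<close>.\<close>
    moreover have "\<beta> * (k - phi k) * (w / (2 * (\<beta> * (k - phi k)))) = w / 2"
      using k(2) beta_nonzero by simp
    moreover have "tr (w / 2) = w" using w by (simp add: tr_of_fixed)
    ultimately show ?thesis by (simp only: G_def)
  qed
  have form1_A: "2 * form1 (A x) y = tr (C (form1 x y))" for x y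
    using C_omega[of "form2 x y"]
    by (simp only: tr_C[symmetric] BH_mult_eq additive.add[OF C_add] tr_add bar_tr simp_thms add_0_right)
  define c where "c = tr (C 1) / 2"
  have bar_c: "bar c = c" by (simp add: c_def)
  have C_fixed: "tr (C u) = 2 * (u * c)" if u: "bar u = u" for u
  proof -
    have "form1 (u / 2) 1 = u" using u by (simp add: tr_of_fixed)
    hence "tr (C u) = 2 * form1 (A (u / 2)) 1" by (simp only: form1_A)
    also have "A (u / 2) = u * A (1 / 2)" using A_scale[OF u, of "1 / 2"] by simp
    also have "2 * form1 (u * A (1 / 2)) 1 = u * (2 * form1 (A (1 / 2)) 1)"
      using tr_scale[OF u, of "A (1 / 2)"] by simp
    also have "2 * form1 (A (1 / 2)) 1 = tr (C 1)"
      by (simp only: form1_A) (simp add: tr_of_fixed)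
    finally show ?thesis by (simp add: c_def)
  qed
  have A: "A x = c * x" for x
  proof (rule form1_nondegenerate)
    fix y
    have "2 * form1 (A x) y = 2 * (form1 x y * c)" by (simp only: form1_A C_fixed bar_tr)
    hence "form1 (A x) y = c * form1 x y" by (simp add: mult.commute)
    thus "form1 (A x) y = form1 (c * x) y"
      using tr_scale[OF bar_c, of "x * bar y"] by (simp only: mult.assoc)
  qed
  have "phi c = c"
  proof -
    have "additive (\<lambda>z. tr (\<beta> * (c - phi c) * z))"
      by standard (simp only: distrib_left tr_add)
    moreover have "tr (\<beta> * (c - phi c) * (x * phi y - phi x * y)) = 0" for x y
    proof -
      have "(c * x) \<star> y = x \<star> (c * y)"
        using AC[of x y] AC[of y x] by (simp add: A BH_mult_commute)
      thus ?thesis using form2_swap_scale[OF bar_c, of x y] omega_nonzero by simp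
    qed
    ultimately have "tr (\<beta> * (c - phi c) * z) = 0" for z
      by (rule additive_vanishing_on_alternating[OF assms(1)])
    hence "\<beta> * (c - phi c) = 0" by (rule tr_nondegenerate)
    thus ?thesis using beta_nonzero by simp
  qed
  with bar_c have c: "c \<in> fixed_q" by (rule fixed_q_if)
  moreover have "C z = c * z" for z
  proof -
    obtain x where "z = x \<star> 1" using times_1 by blast
    thus ?thesis using AC[of x 1] c by (simp add: A fixed_q_scalars)
  qed
  ultimately show ?thesis using A by (intro bexI[of _ c]) auto
qed

lemma right_iff_left_BH: "(\<forall>x y. x \<star> B y = C (x \<star> y)) \<longleftrightarrow> (\<forall>x y. B x \<star> y = C (x \<star> y))"
  by (metis BH_mult_commute)

lemma scalar_pairs_BH:
  assumes "l > 1"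
  shows "left_pairs mult = (\<lambda>c. (\<lambda>x. c * x, \<lambda>x. c * x)) ` fixed_q"
    and "right_pairs mult = (\<lambda>c. (\<lambda>x. c * x, \<lambda>x. c * x)) ` fixed_q"
    and "central_triples mult = (\<lambda>c. (\<lambda>x. c * x, \<lambda>x. c * x, \<lambda>x. c * x)) ` fixed_q"
proof -
  have left: "(\<forall>x y. A x \<star> y = C (x \<star> y)) \<longleftrightarrow>
      (\<exists>c\<in>fixed_q. A = (\<lambda>x. c * x) \<and> C = (\<lambda>x. c * x))" for A C
  proof
    assume "\<forall>x y. A x \<star> y = C (x \<star> y)"
    thus "\<exists>c\<in>fixed_q. A = (\<lambda>x. c * x) \<and> C = (\<lambda>x. c * x)"
      by (intro left_pair_BH[OF assms]) simp
  next
    assume "\<exists>c\<in>fixed_q. A = (\<lambda>x. c * x) \<and> C = (\<lambda>x. c * x)"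
    thus "\<forall>x y. A x \<star> y = C (x \<star> y)" using fixed_q_scalars(1) by blast
  qed
  note right = left[folded right_iff_left_BH]
  have scalar_eqD: "c = c'" if "(\<lambda>x. c * x) = (\<lambda>x. c' * x)" for c c' :: 'a
    using fun_cong[OF that, of 1] by simp
  show "left_pairs mult = (\<lambda>c. (\<lambda>x. c * x, \<lambda>x. c * x)) ` fixed_q"
    unfolding left_pairs_def left by blast
  show "right_pairs mult = (\<lambda>c. (\<lambda>x. c * x, \<lambda>x. c * x)) ` fixed_q"
    unfolding right_pairs_def right by blast
  show "central_triples mult = (\<lambda>c. (\<lambda>x. c * x, \<lambda>x. c * x, \<lambda>x. c * x)) ` fixed_q"
    unfolding central_triples_def all_conj_distrib left right
    by (auto dest: scalar_eqD)
qed

lemma card_scalar_pairs_BH: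
  assumes "l > 1"
  shows "card (left_pairs mult) = q" "card (right_pairs mult) = q" "card (central_triples mult) = q"
proof -
  have scalar_eqD: "c = c'" if "(\<lambda>x. c * x) = (\<lambda>x. c' * x)" for c c' :: 'a
    using fun_cong[OF that, of 1] by simp
  have "inj_on (\<lambda>c. (\<lambda>x. c * x, \<lambda>x. c * x)) fixed_q"
    "inj_on (\<lambda>c. (\<lambda>x. c * x, \<lambda>x. c * x, \<lambda>x. c * x)) fixed_q"
    by (auto intro!: inj_onI dest: scalar_eqD)
  thus "card (left_pairs mult) = q" "card (right_pairs mult) = q" "card (central_triples mult) = q"
    by (simp_all only: scalar_pairs_BH[OF assms] card_image card_fixed_q)
qed

end

section \<open>Orders of the nuclei and the center\<close>

theorem theorem4p1:
  fixes q l d :: nat and \<beta> \<omega> :: "'a::finite_field"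
  assumes "BH_parameters q l d \<beta> \<omega>" and "l > 1"
  shows "presemifield (BH_mult q l d \<beta> \<omega>) \<and>
    (\<exists>star :: 'a \<Rightarrow> 'a \<Rightarrow> 'a. semifield star \<and> isotopic (BH_mult q l d \<beta> \<omega>) star) \<and>
    (\<forall>star :: 'b::{ab_group_add, finite} \<Rightarrow> 'b \<Rightarrow> 'b.
       semifield star \<and> isotopic (BH_mult q l d \<beta> \<omega>) star \<longrightarrow>
         card (middle_nucleus star) = q ^ 2 \<and>
         card (right_nucleus star) = q \<and>
         card (left_nucleus star) = q \<and>
         card (semifield_center star) = q)"
proof (intro conjI allI impI)
  interpret BH_presemifield q l d \<beta> \<omega> by standard fact
  show presemifield: "presemifield (BH_mult q l d \<beta> \<omega>)" by (rule presemifield_BH)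
  have "prime_field_scale CHAR('a) x = 0" for x :: 'a
    by (simp add: prime_field_scale_def)
  with presemifield show "\<exists>star :: 'a \<Rightarrow> 'a \<Rightarrow> 'a. semifield star \<and> isotopic (BH_mult q l d \<beta> \<omega>) star"
    by (intro presemifield.isotopic_to_semifield[where p = "CHAR('a)"]) auto
  fix star :: "'b \<Rightarrow> 'b \<Rightarrow> 'b"
  assume "semifield star \<and> isotopic (BH_mult q l d \<beta> \<omega>) star"
  hence "semifield star" and iso: "isotopic (BH_mult q l d \<beta> \<omega>) star" by auto
  then interpret semifield star by simp
  obtain e where e: "\<And>x. star e x = x" "\<And>x. star x e = x" using has_identity by blast
  note cards = card_nuclei_unital[OF e] card_pairs_isotopic[OF iso, symmetric]
  show "card (middle_nucleus star) = q ^ 2"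
    by (simp only: cards card_middle_pairs_BH[OF assms(2)])
  show "card (right_nucleus star) = q" "card (left_nucleus star) = q"
    "card (semifield_center star) = q"
    by (simp_all only: cards card_scalar_pairs_BH[OF assms(2)])
qed

end
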